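(* For arbitrary integers $m>2$, $n\geq m+1$, $d\geq 1$ there exists a prime integral point set $M$ of $n$ points in $\mathbb{R}^m$ containing points $M_1,M_2$ with $|M_1M_2|=d$, such that $d$ is the minimal distance occurring in $M$ and $\{M_1,M_2\}$ is the only pair of points of $M$ at distance $d$.
   Context: An integral point set in $\mathbb{R}^m$ is a finite set $M\subset\mathbb{R}^m$ such that all pairwise Euclidean distances between points of $M$ are integers and $M$ is not contained in any $(m-1)$-dimensional affine hyperplane. An integral point set is prime if the greatest common divisor of all distances occurring between its points is $1$. *)

theory Defs
  imports "HOL-Analysis.Analysis"
begin

definition distances :: "'a::metric_space set \<Rightarrow> real set" where
  "distances M = {dist x y | x y. x \<in> M \<and> y \<in> M \<and> x \<noteq> y}"

definition integral_point_set :: "'a::euclidean_space set \<Rightarrow> bool" where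
  "integral_point_set M \<longleftrightarrow>
     finite M \<and>
     distances M \<subseteq> \<int> \<and>
     \<not> (\<exists>H. affine H \<and> aff_dim H = int (DIM('a)) - 1 \<and> M \<subseteq> H)"

text \<open>
  The gcd is taken over the natural numbers that occur as
  distances; in an integral point set these are all the distances.
\<close>

definition prime_integral_point_set :: "'a::euclidean_space set \<Rightarrow> bool" where
  "prime_integral_point_set M \<longleftrightarrow>
     integral_point_set M \<and> Gcd {k::nat. real k \<in> distances M} = 1"

end

theory Submission imports Defs begin

text \<open>
  Put \<open>n - m + 1\<close> points \<open>t\<^sub>i e\<^sub>c\<close> on a coordinate axis, and \<open>m - 1\<close> further points on a sphere of
  squared radius \<open>D\<close> in the orthogonal complement of that axis: these are multiples of the
  remaining basis vectors, hence at distance \<open>sqrt (2 D)\<close> from each other, except that two of them are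
  pushed together inside their coordinate plane until their distance is \<open>d\<close>. The distances between
  the two groups are \<open>sqrt (D + t\<^sub>i\<^sup>2)\<close>. With \<open>D = 8 (d 2\<^sup>N)\<^sup>2\<close> both \<open>2 D\<close> is a square and
  \<open>D\<close> has many factorizations \<open>(b\<^sub>i - t\<^sub>i) (b\<^sub>i + t\<^sub>i)\<close>; the one with \<open>b\<^sub>0 = 2 (d 2\<^sup>N)\<^sup>2 + 1\<close>
  gives a distance coprime to \<open>d\<close>.
\<close>

text \<open>Each factorization \<open>x * y = 2 * (d * 2 ^ N)\<^sup>2\<close> gives a solution
  \<open>b = x + y\<close>, \<open>t = y - x\<close>, since (x + y)^2 - (y - x)^2 = 4xy. Shifting
  powers of 2 from \<open>y\<close> to \<open>x\<close> yields \<open>N + 1\<close> of them.\<close>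

lemma pythagorean_legs:
  fixes d N :: nat
  assumes "d \<ge> 1"
  obtains t b :: "nat \<Rightarrow> nat" where
    "\<And>i. i \<le> N \<Longrightarrow> (b i)\<^sup>2 = (t i)\<^sup>2 + 8 * (d * 2 ^ N)\<^sup>2"
    "\<And>i j. i < j \<Longrightarrow> j \<le> N \<Longrightarrow> t j + d < t i"
    "\<And>i. i \<le> N \<Longrightarrow> d < b i"
    "coprime (b 0) d"
proof -
  \<comment> \<open>All of \<open>d\<^sup>2\<close> goes into \<open>y\<close>, so that
    \<open>x 0 = 1\<close> while \<open>d\<close> divides \<open>y 0\<close>. The exponent of 2 in
    \<open>y i\<close> is at least \<open>N + 1\<close>, which keeps \<open>x i < y i\<close> and
    \<open>y i - x i\<close> untruncated.\<close>
  define x y :: "nat \<Rightarrow> nat" where "x i = 2 ^ i" and "y i = d\<^sup>2 * 2 ^ (2 * N + 1 - i)" for i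
  have dd: "d \<le> d\<^sup>2" by (simp add: power2_nat_le_imp_le self_le_power assms)
  have xy: "x i * y i = 2 * (d * 2 ^ N)\<^sup>2" if "i \<le> N" for i
  proof -
    have "(2::nat) ^ i * 2 ^ (2 * N + 1 - i) = 2 ^ (2 * N + 1)"
      using that by (simp flip: power_add)
    then have "x i * y i = d\<^sup>2 * 2 ^ (2 * N + 1)"
      by (simp add: x_def y_def)
    also have "\<dots> = 2 * (d * 2 ^ N)\<^sup>2"
      by (simp add: power_mult_distrib power_even_eq)
    finally show ?thesis .
  qed
  have d2: "1 \<le> d\<^sup>2" using assms by simp
  have xle: "x i < y i" if "i \<le> N" for i
  proof -
    have "x i < 2 ^ (2 * N + 1 - i)"
      unfolding x_def using that by (intro power_strict_increasing) auto
    also have "\<dots> \<le> y i" unfolding y_def using d2 by simp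
    finally show ?thesis .
  qed
  have step: "y j + d < y i" if "i < j" "j \<le> N" for i j
  proof -
    \<comment> \<open>Passing from \<open>i\<close> to \<open>j\<close> at least halves
      \<open>y\<close>, and \<open>y j\<close> is at least 2d^2, so the drop exceeds
      \<open>d\<close>.\<close>
    have "(2::nat) ^ Suc (2 * N + 1 - j) \<le> 2 ^ (2 * N + 1 - i)"
      using that by (intro power_increasing) auto
    then have "d\<^sup>2 * 2 ^ Suc (2 * N + 1 - j) \<le> y i"
      unfolding y_def by (rule mult_left_mono) simp
    then have a: "2 * y j \<le> y i" by (simp add: y_def)
    have "(2::nat) ^ 1 \<le> 2 ^ (2 * N + 1 - j)"
      using that by (intro power_increasing) auto
    then have "d\<^sup>2 * 2 \<le> y j" unfolding y_def by (intro mult_left_mono) auto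
    with a dd d2 show ?thesis by linarith
  qed
  show ?thesis
  proof (rule that[of "\<lambda>i. x i + y i" "\<lambda>i. y i - x i"])
    show "(x i + y i)\<^sup>2 = (y i - x i)\<^sup>2 + 8 * (d * 2 ^ N)\<^sup>2" if "i \<le> N" for i
    proof -
      have "x i < y i" using that by (rule xle)
      then obtain k where "y i = x i + k" using less_imp_add_positive by metis
      then have "(x i + y i)\<^sup>2 = (y i - x i)\<^sup>2 + 4 * (x i * y i)"
        by (simp add: power2_eq_square algebra_simps)
      with xy[OF that] show ?thesis by simp
    qed
    show "y j - x j + d < y i - x i" if "i < j" "j \<le> N" for i j
    proof -
      have "x i < x j" unfolding x_def using that by (intro power_strict_increasing) auto
      with step[OF that] xle[of i] xle[of j] that show ?thesis by linarith
    qed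
    show "d < x i + y i" if "i \<le> N" for i
    proof -
      have "d\<^sup>2 * 1 \<le> y i" unfolding y_def by (intro mult_left_mono) auto
      moreover have "0 < x i" by (simp add: x_def)
      ultimately show ?thesis using dd by linarith
    qed
    \<comment> \<open>A common divisor of \<open>x 0 + y 0\<close> and \<open>d\<close> divides
      \<open>y 0\<close>, hence also \<open>x 0 = 1\<close>.\<close>
    have "d dvd y 0" by (simp add: y_def power2_eq_square)
    then have "e dvd 1" if "e dvd x 0 + y 0" "e dvd d" for e
      using that dvd_trans[of e d "y 0"] dvd_add_left_iff[of e "y 0" "x 0"] by (simp add: x_def)
    then show "coprime (x 0 + y 0) d"
      by (intro coprimeI) auto
  qed
qed

text \<open>Only the vectors at \<open>a\<close> and \<open>b\<close> leave their axes: they become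
  mirror images in axis \<open>a\<close>, with lengths unchanged. They stay in their coordinate
  plane and still span it, so orthogonality to the others and the full span survive.\<close>

lemma orthogonal_frame_with_short_edge:
  fixes a b c :: "'m::finite" and d D :: real
  assumes abc: "a \<noteq> b" "a \<noteq> c" "b \<noteq> c" and d: "0 < d" "d\<^sup>2 < 4 * D"
  obtains s :: "'m \<Rightarrow> real ^ 'm" where
    "\<And>j. j \<noteq> c \<Longrightarrow> s j $ c = 0"
    "\<And>j. j \<noteq> c \<Longrightarrow> s j \<bullet> s j = D"
    "dist (s a) (s b) = d"
    "\<And>i j. i \<noteq> j \<Longrightarrow> {i, j} \<noteq> {a, b} \<Longrightarrow> i \<noteq> c \<Longrightarrow> j \<noteq> c \<Longrightarrow> s i \<bullet> s j = 0"
    "span (insert (axis c 1) (s ` (- {c}))) = UNIV"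
proof -
  \<comment> \<open>The height of the isosceles triangle with legs \<open>sqrt D\<close> and base
    \<open>d\<close>; it is positive because d^2 < 4D.\<close>
  define u where "u = sqrt (D - d\<^sup>2 / 4)"
  have u: "u > 0" and u2: "u * u = D - d\<^sup>2 / 4" using d by (auto simp: u_def)
  have D: "D > 0" using d by (smt (verit) zero_le_power2)
  define s :: "'m \<Rightarrow> real ^ 'm" where
    "s j = (if j = a then axis a u + axis b (d / 2)
            else if j = b then axis a u - axis b (d / 2) else axis j (sqrt D))" for j
  have sa: "s a = axis a u + axis b (d / 2)" and sb: "s b = axis a u - axis b (d / 2)"
    and sj: "\<And>j. j \<noteq> a \<Longrightarrow> j \<noteq> b \<Longrightarrow> s j = axis j (sqrt D)"
    using abc by (auto simp: s_def)
  show ?thesis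
  proof (rule that[of s])
    show "s j $ c = 0" if "j \<noteq> c" for j
      using that abc by (auto simp: s_def axis_def)
    show "s j \<bullet> s j = D" if "j \<noteq> c" for j
      using that abc D
      by (auto simp: s_def inner_axis_axis inner_add_left inner_add_right inner_diff_left
          inner_diff_right u2 power2_eq_square)
    have "s a - s b = axis b d"
      by (simp add: sa sb vec_eq_iff axis_def)
    then show "dist (s a) (s b) = d" using d by (simp add: dist_norm norm_eq_sqrt_inner inner_axis_axis)
    show "s i \<bullet> s j = 0" if "i \<noteq> j" "{i, j} \<noteq> {a, b}" "i \<noteq> c" "j \<noteq> c" for i j
      using that abc
      by (auto simp: s_def inner_axis_axis inner_add_left inner_add_right inner_diff_left
          inner_diff_right)
    let ?V = "span (insert (axis c 1) (s ` (- {c})))"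
    have sV: "s j \<in> ?V" if "j \<noteq> c" for j
      using that by (intro span_base) auto
    \<comment> \<open>Axes \<open>a\<close> and \<open>b\<close> are recovered from the sum and the
      difference of \<open>s a\<close> and \<open>s b\<close>.\<close>
    have "axis j 1 \<in> ?V" for j
    proof -
      consider "j = c" | "j = a" | "j = b" | "j \<noteq> a" "j \<noteq> b" "j \<noteq> c" by blast
      then show ?thesis
      proof cases
        case 1
        then show ?thesis by (intro span_base) auto
      next
        case 2
        have "(1 / (2 * u)) *\<^sub>R (s a + s b) \<in> ?V"
          using abc by (intro span_scale span_add sV) auto
        moreover have "(1 / (2 * u)) *\<^sub>R (s a + s b) = axis j 1"
          using u 2 by (simp add: sa sb vec_eq_iff axis_def)
        ultimately show ?thesis by simp
      next
        case 3
        have "(1 / d) *\<^sub>R (s a - s b) \<in> ?V"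
          using abc by (intro span_scale span_diff sV) auto
        moreover have "(1 / d) *\<^sub>R (s a - s b) = axis j 1"
          using d 3 by (simp add: sa sb vec_eq_iff axis_def)
        ultimately show ?thesis by simp
      next
        case 4
        have "(1 / sqrt D) *\<^sub>R s j \<in> ?V"
          using 4 by (intro span_scale sV)
        moreover have "(1 / sqrt D) *\<^sub>R s j = axis j 1"
          using D 4 by (simp add: sj vec_eq_iff axis_def)
        ultimately show ?thesis by simp
      qed
    qed
    then have "Basis \<subseteq> ?V" by (auto simp: Basis_vec_def)
    then have "span Basis \<subseteq> ?V" by (rule span_minimal) (rule subspace_span)
    then show "?V = UNIV" by (simp add: top.extremum_unique)
  qed
qed

text \<open>The line through the two points passes through 0 and has direction \<open>e\<close>.
  This turns a question about affine hyperplanes into one about linear spans.\<close>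

lemma affine_two_points_on_axis:
  fixes H :: "'a::real_vector set"
  assumes "affine H" "p *\<^sub>R e \<in> H" "q *\<^sub>R e \<in> H" "p \<noteq> q"
  shows "subspace H" "e \<in> H"
proof -
  have "(q / (q - p)) *\<^sub>R (p *\<^sub>R e) + (- p / (q - p)) *\<^sub>R (q *\<^sub>R e) \<in> H"
  proof (rule mem_affine[OF assms(1-3)])
    have "q / (q - p) + - p / (q - p) = (q - p) / (q - p)"
      unfolding diff_divide_distrib by simp
    then show "q / (q - p) + - p / (q - p) = 1" using assms(4) by simp
  qed
  moreover have "(q / (q - p)) *\<^sub>R (p *\<^sub>R e) + (- p / (q - p)) *\<^sub>R (q *\<^sub>R e) = 0"
    by (simp add: mult.commute)
  ultimately have "0 \<in> H" by metis
  with assms show H: "subspace H" by (simp add: subspace_affine)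
  have "(1 / (p - q)) *\<^sub>R (p *\<^sub>R e - q *\<^sub>R e) \<in> H"
    by (intro subspace_scale[OF H] subspace_diff[OF H] assms)
  moreover have "(1 / (p - q)) *\<^sub>R (p *\<^sub>R e - q *\<^sub>R e) = e"
    using assms(4) unfolding scaleR_diff_left[symmetric] by simp
  ultimately show "e \<in> H" by metis
qed

theorem theorem8:
  fixes n d :: nat
  assumes "CARD('m::finite) > 2" and "n \<ge> CARD('m) + 1" and "d \<ge> 1"
  shows "\<exists>M :: (real ^ 'm) set.
           prime_integral_point_set M \<and> card M = n \<and>
           (\<exists>M\<^sub>1\<in>M. \<exists>M\<^sub>2\<in>M.
              dist M\<^sub>1 M\<^sub>2 = real d \<and>
              (\<forall>r\<in>distances M. real d \<le> r) \<and>
              (\<forall>x\<in>M. \<forall>y\<in>M. dist x y = real d \<longrightarrow> {x, y} = {M\<^sub>1, M\<^sub>2}))"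
proof -

  \<comment> \<open>Choice of the parameters and points\<close>
  have "3 \<le> card (UNIV :: 'm set)" using assms(1) by simp
  then obtain T :: "'m set" where "card T = 3" by (meson obtain_subset_with_card_n)
  then obtain a b c :: 'm where abc: "a \<noteq> b" "a \<noteq> c" "b \<noteq> c"
    by (auto simp: card_3_iff)
  \<comment> \<open>The axis carries the \<open>N + 1\<close> points \<open>p 0\<close>, ...,
    \<open>p N\<close>; n \<ge> m + 1 makes them at least two.\<close>
  define N where "N = n - CARD('m)"
  have N: "N \<ge> 1" using assms(2) by (simp add: N_def)
  obtain t h :: "nat \<Rightarrow> nat" where
    h2: "\<And>i. i \<le> N \<Longrightarrow> (h i)\<^sup>2 = (t i)\<^sup>2 + 8 * (d * 2 ^ N)\<^sup>2" and
    tsep: "\<And>i j. i < j \<Longrightarrow> j \<le> N \<Longrightarrow> t j + d < t i" and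
    hd: "\<And>i. i \<le> N \<Longrightarrow> d < h i" and
    cop: "coprime (h 0) d"
    using pythagorean_legs[OF assms(3), of N] by metis
  define k where "k = d * 2 ^ N"
  define D where "D = 8 * (real k)\<^sup>2"
  have dk: "d \<le> k" by (simp add: k_def)
  have dD: "(real d)\<^sup>2 < 4 * D"
  proof -
    have "(real d)\<^sup>2 \<le> (real k)\<^sup>2" using dk by (simp add: power_mono)
    moreover have "0 < (real k)\<^sup>2" using dk assms(3) by simp
    ultimately show ?thesis unfolding D_def by linarith
  qed
  obtain s :: "'m \<Rightarrow> real ^ 'm" where
    sc: "\<And>j. j \<noteq> c \<Longrightarrow> s j $ c = 0" and
    sD: "\<And>j. j \<noteq> c \<Longrightarrow> s j \<bullet> s j = D" and
    sab: "dist (s a) (s b) = real d" and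
    orth: "\<And>i j. i \<noteq> j \<Longrightarrow> {i, j} \<noteq> {a, b} \<Longrightarrow> i \<noteq> c \<Longrightarrow> j \<noteq> c \<Longrightarrow> s i \<bullet> s j = 0" and
    sspan: "span (insert (axis c 1) (s ` (- {c}))) = UNIV"
    using orthogonal_frame_with_short_edge[OF abc, of "real d" D] dD assms(3) by auto
  define e :: "real ^ 'm" where "e = axis c 1"
  define p where "p i = real (t i) *\<^sub>R e" for i
  define S where "S = s ` (- {c})"
  define P where "P = p ` {..N}"
  define M where "M = S \<union> P"

  \<comment> \<open>Distances inside and between the two groups\<close>
  have dist_SS: "dist (s i) (s j) = 4 * real k"
    if "i \<noteq> j" "{i, j} \<noteq> {a, b}" "i \<noteq> c" "j \<noteq> c" for i j
  proof -
    have "(dist (s i) (s j))\<^sup>2 = (4 * real k)\<^sup>2"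
      using orth[OF that] sD that
      by (simp add: dist_norm power2_norm_eq_inner inner_diff_left inner_diff_right
          inner_commute D_def power_mult_distrib)
    then show ?thesis by (rule power2_eq_imp_eq) simp_all
  qed
  have dist_SP: "dist (s j) (p i) = h i" if "j \<noteq> c" "i \<le> N" for i j
  proof -
    \<comment> \<open>Pythagoras: \<open>s j\<close> has no \<open>c\<close>-coordinate, so it is
      orthogonal to \<open>p i\<close>.\<close>
    have "(dist (s j) (p i))\<^sup>2 = D + real (t i) * real (t i)"
      using sD[OF that(1)] sc[OF that(1)]
      by (simp add: dist_norm power2_norm_eq_inner inner_diff_left inner_diff_right p_def e_def
          inner_axis inner_axis_axis inner_commute[of "axis _ _"])
    also have "\<dots> = (real (h i))\<^sup>2"
      using arg_cong[OF h2[OF that(2)], of real] by (simp add: D_def k_def power2_eq_square)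
    finally show ?thesis by (rule power2_eq_imp_eq) simp_all
  qed
  have dist_PP: "dist (p i) (p j) = real (t i - t j)" "t i - t j > d" if "i < j" "j \<le> N" for i j
  proof -
    have "p i - p j = (real (t i) - real (t j)) *\<^sub>R e"
      by (simp add: p_def scaleR_diff_left)
    then show "dist (p i) (p j) = real (t i - t j)"
      using tsep[OF that] by (simp add: dist_norm e_def)
    show "t i - t j > d" using tsep[OF that] by linarith
  qed
  have sym: "(\<exists>k>d. dist x y = real k) \<longleftrightarrow> (\<exists>k>d. dist y x = real k)" for x y :: "real ^ 'm"
    by (simp add: dist_commute)
  have SS: "{x, y} = {s a, s b} \<or> (\<exists>k>d. dist x y = real k)" if "x \<in> S" "y \<in> S" "x \<noteq> y" for x y
  proof -
    obtain i j where ij: "x = s i" "y = s j" "i \<noteq> c" "j \<noteq> c" "i \<noteq> j"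
      using \<open>x \<in> S\<close> \<open>y \<in> S\<close> \<open>x \<noteq> y\<close> by (auto simp: S_def)
    show ?thesis
    proof (cases "{i, j} = {a, b}")
      case True
      then show ?thesis using ij by (auto simp: doubleton_eq_iff)
    next
      case False
      then have "dist x y = real (4 * k)" using dist_SS ij by simp
      moreover have "4 * k > d" using dk assms(3) by linarith
      ultimately show ?thesis by blast
    qed
  qed
  have SP: "\<exists>k>d. dist x y = real k" if "x \<in> S" "y \<in> P" for x y
    using that dist_SP hd by (force simp: S_def P_def)
  have PP: "\<exists>k>d. dist x y = real k" if "x \<in> P" "y \<in> P" "x \<noteq> y" for x y
  proof -
    obtain i j where ij: "x = p i" "y = p j" "i \<le> N" "j \<le> N"
      using \<open>x \<in> P\<close> \<open>y \<in> P\<close> by (auto simp: P_def)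
    then have "i < j \<or> j < i" using \<open>x \<noteq> y\<close> by (metis linorder_neqE_nat)
    then show ?thesis using ij dist_PP by (metis dist_commute)
  qed
  \<comment> \<open>This dichotomy is the source of integrality, minimality and uniqueness
    alike.\<close>
  have MM: "{x, y} = {s a, s b} \<or> (\<exists>k>d. dist x y = real k)" if "x \<in> M" "y \<in> M" "x \<noteq> y" for x y
    using that SS[of x y] SP[of x y] SP[of y x] PP[of x y] sym[of x y] unfolding M_def by blast
  have sd: "dist x y = real d" if "{x, y} = {s a, s b}" for x y
    using that sab by (auto simp: doubleton_eq_iff dist_commute)

  \<comment> \<open>Number of points\<close>
  have inj_s: "inj_on s (- {c})"
  proof (rule inj_onI, rule ccontr)
    fix i j assume ij: "i \<in> - {c}" "j \<in> - {c}" "s i = s j" "i \<noteq> j"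
    show False
    proof (cases "{i, j} = {a, b}")
      case True
      then show ?thesis using ij sab assms(3) by (auto simp: doubleton_eq_iff)
    next
      case False
      then show ?thesis using ij dist_SS[of i j] dk assms(3) by simp
    qed
  qed
  have inj_p: "inj_on p {..N}"
    by (rule linorder_inj_onI) (use dist_PP in force)+
  have "card S = CARD('m) - 1"
    unfolding S_def card_image[OF inj_s] by (simp add: Compl_eq_Diff_UNIV card_Diff_singleton)
  moreover have "card P = N + 1"
    by (simp add: P_def card_image[OF inj_p])
  moreover have "S \<inter> P = {}" using SP by fastforce
  moreover have finS: "finite S" and finP: "finite P" by (auto simp: S_def P_def)
  ultimately have cardM: "card M = n"
    using assms(1,2) by (simp add: M_def card_Un_disjoint N_def)

  \<comment> \<open>No hyperplane contains the points\<close>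
  have full: False if H: "affine H" "aff_dim H = int DIM(real ^ 'm) - 1" "M \<subseteq> H" for H
  proof -
    \<comment> \<open>Two distinct axis points force 0 and \<open>e\<close> into \<open>H\<close>;
      together with \<open>S\<close> this gives a spanning set inside a subspace.\<close>
    have "p 0 \<in> H" "p 1 \<in> H" using H N by (auto simp: M_def P_def)
    moreover have "t 0 \<noteq> t 1" using tsep[of 0 1] N by auto
    ultimately have sub: "subspace H" and eH: "e \<in> H"
      using affine_two_points_on_axis[OF H(1), of "real (t 0)" e "real (t 1)"]
      by (auto simp: p_def)
    have "insert e S \<subseteq> H" using eH H by (auto simp: M_def)
    then have "span (insert e S) \<subseteq> H" using sub by (rule span_minimal)
    then have "H = UNIV" using sspan by (auto simp: S_def e_def)
    with H(2) show False by (simp add: aff_dim_UNIV)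
  qed
  have "distances M \<subseteq> \<int>"
    using MM sd by (fastforce simp: distances_def)
  then have ips: "integral_point_set M"
    using full finS finP unfolding integral_point_set_def by (auto simp: M_def)

  \<comment> \<open>Primality and the unique shortest pair\<close>
  have aM: "s a \<in> M" and bM: "s b \<in> M" and pM: "p 0 \<in> M"
    using abc by (auto simp: M_def S_def P_def)
  have ab: "s a \<noteq> s b" using sab assms(3) by auto
  have dd: "real d \<in> distances M"
    unfolding distances_def using aM bM ab sab by force
  have "s a \<noteq> p 0" using dist_SP[of a 0] abc hd[of 0] by auto
  then have hM: "real (h 0) \<in> distances M"
    unfolding distances_def using aM pM dist_SP[of a 0] abc by force
  let ?G = "Gcd {k::nat. real k \<in> distances M}"
  \<comment> \<open>The two distances \<open>d\<close> and \<open>h 0\<close> are already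
    coprime.\<close>
  have "?G dvd d" "?G dvd h 0" using dd hM by (auto intro: Gcd_dvd)
  then have "?G = 1" using cop by (metis coprime_common_divisor_nat)
  with ips have prime: "prime_integral_point_set M" by (simp add: prime_integral_point_set_def)

  have least: "\<forall>r\<in>distances M. real d \<le> r"
    using MM sd by (fastforce simp: distances_def)
  have uniq: "\<forall>x\<in>M. \<forall>y\<in>M. dist x y = real d \<longrightarrow> {x, y} = {s a, s b}"
  proof (intro ballI impI)
    fix x y assume xy: "x \<in> M" "y \<in> M" "dist x y = real d"
    then have "x \<noteq> y" using assms(3) by auto
    with xy MM[of x y] show "{x, y} = {s a, s b}" by auto
  qed
  show ?thesis
    using prime cardM aM bM sab least uniq by blast
qed

end
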